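(* Let $B$ be a one-dimensional standard Brownian motion with $B(0)=0$, let $\ell\in\mathcal{D}^-[0,\infty)$, $r\in\mathcal{D}^+[0,\infty)$ with $\ell\le r$, let $x\in\mathbb{R}$, let $W=\overline{\Gamma}_{\ell,r}(x+B)$ and $Y=W-x-B$. Let $\tau=\inf\{t>0: r(t)=\ell(t)\text{ or } r(t-)=\ell(t-)\}$ and assume $\tau\in(0,\infty)$. Let $K'\subseteq\mathbb{Z}$ and let $K$ be $K'$ with its largest element removed (if $K'$ has a largest element; otherwise $K=K'$). Suppose there is a strictly increasing sequence $\{s_k\}_{k\in K'}$ with values in $[0,\tau]$ and a constant $c_1\in(-\infty,\infty)$ such that for all $k\in K$ $$\frac{\min\big(r(s_{k+1})-\ell(s_k),\,-\ell(s_{k+1})+r(s_k)\big)}{(s_{k+1}-s_k)^{1/2}}\le c_1.$$ If $\sum_{k\in K}(s_{k+1}-s_k)^{1/2}=\infty$, then $\mathcal{V}_{[0,\tau]}Y=\infty$ almost surely.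
   Context: $\mathcal{D}[0,\infty)$ denotes the càdlàg functions $[0,\infty)\to(-\infty,\infty)$; $\mathcal{D}^-[0,\infty)$ (resp. $\mathcal{D}^+[0,\infty)$) denotes càdlàg functions with values in $[-\infty,\infty)$ (resp. $(-\infty,\infty]$). $\mathcal{V}_{[t_1,t_2]}(f)$ is the total variation of $f$ on $[t_1,t_2]$. ESP: $(\phi,\eta)\in\mathcal{D}[0,\infty)^2$ solves the extended Skorokhod problem on $[\ell(\cdot),r(\cdot)]$ for $\psi\in\mathcal{D}[0,\infty)$ if (1) $\phi(t)=\psi(t)+\eta(t)\in[\ell(t),r(t)]$ for all $t\ge0$; (2) for all $0\le s\le t$: $\eta(t)-\eta(s)\ge0$ if $\phi(u)<r(u)$ for all $u\in(s,t]$, and $\eta(t)-\eta(s)\le0$ if $\phi(u)>\ell(u)$ for all $u\in(s,t]$; (3) for all $t\ge0$: $\eta(t)-\eta(t-)\ge0$ if $\phi(t)<r(t)$, and $\eta(t)-\eta(t-)\le0$ if $\phi(t)>\ell(t)$, where $\eta(0-)=0$. For $\ell\le r$ this problem has a unique solution for every $\psi$; $\overline{\Gamma}_{\ell,r}(\psi)$ denotes its first component (applied pathwise). $W$ is the reflected Brownian motion on $[\ell(\cdot),r(\cdot)]$ and $Y$ its local time on the boundary. *)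

theory Defs
  imports "HOL-Probability.Probability"
begin

text \<open>Left limit f(t-) of a function; meaningful for t > 0 where it exists.\<close>
definition left_lim :: "(real \<Rightarrow> 'b::t2_space) \<Rightarrow> real \<Rightarrow> 'b" where
  "left_lim f t = Lim (at_left t) f"

definition cadlag :: "(real \<Rightarrow> 'b::topological_space) \<Rightarrow> bool" where
  "cadlag f \<longleftrightarrow> (\<forall>t\<ge>0. (f \<longlongrightarrow> f t) (at_right t)) \<and>
                 (\<forall>t>0. \<exists>L. (f \<longlongrightarrow> L) (at_left t))"

definition D_minus :: "(real \<Rightarrow> ereal) set" where
  "D_minus = {f. cadlag f \<and> (\<forall>t\<ge>0. f t \<noteq> \<infinity>)}"

definition D_plus :: "(real \<Rightarrow> ereal) set" where
  "D_plus = {f. cadlag f \<and> (\<forall>t\<ge>0. f t \<noteq> -\<infinity>)}"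

definition eta_minus :: "(real \<Rightarrow> real) \<Rightarrow> real \<Rightarrow> real" where
  "eta_minus \<eta> t = (if t = 0 then 0 else left_lim \<eta> t)"

definition ESP :: "(real \<Rightarrow> ereal) \<Rightarrow> (real \<Rightarrow> ereal) \<Rightarrow> (real \<Rightarrow> real)
                    \<Rightarrow> (real \<Rightarrow> real) \<Rightarrow> (real \<Rightarrow> real) \<Rightarrow> bool" where
  "ESP lo r \<psi> \<phi> \<eta> \<longleftrightarrow>
     cadlag \<phi> \<and> cadlag \<eta> \<and>
     (\<forall>t\<ge>0. \<phi> t = \<psi> t + \<eta> t \<and> lo t \<le> ereal (\<phi> t) \<and> ereal (\<phi> t) \<le> r t) \<and>
     (\<forall>s t. 0 \<le> s \<and> s \<le> t \<longrightarrow>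
        ((\<forall>u\<in>{s<..t}. ereal (\<phi> u) < r u) \<longrightarrow> \<eta> t - \<eta> s \<ge> 0) \<and>
        ((\<forall>u\<in>{s<..t}. ereal (\<phi> u) > lo u) \<longrightarrow> \<eta> t - \<eta> s \<le> 0)) \<and>
     (\<forall>t\<ge>0.
        (ereal (\<phi> t) < r t \<longrightarrow> \<eta> t - eta_minus \<eta> t \<ge> 0) \<and>
        (ereal (\<phi> t) > lo t \<longrightarrow> \<eta> t - eta_minus \<eta> t \<le> 0))"

text \<open>First component of the (unique) ESP solution; only values on [0,oo) are meaningful.\<close>
definition Gamma_bar :: "(real \<Rightarrow> ereal) \<Rightarrow> (real \<Rightarrow> ereal) \<Rightarrow> (real \<Rightarrow> real) \<Rightarrow> real \<Rightarrow> real" where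
  "Gamma_bar lo r \<psi> = (THE \<phi>. (\<exists>\<eta>. ESP lo r \<psi> \<phi> \<eta>) \<and> (\<forall>t<0. \<phi> t = 0))"

definition total_variation :: "(real \<Rightarrow> real) \<Rightarrow> real \<Rightarrow> real \<Rightarrow> ereal" where
  "total_variation f a b =
     (SUP (n, t) \<in> {(n::nat, t::nat \<Rightarrow> real). t 0 = a \<and> t n = b \<and> (\<forall>i<n. t i \<le> t (Suc i))}.
        ereal (\<Sum>i<n. \<bar>f (t (Suc i)) - f (t i)\<bar>))"

definition std_brownian_motion :: "'a measure \<Rightarrow> (real \<Rightarrow> 'a \<Rightarrow> real) \<Rightarrow> bool" where
  "std_brownian_motion M B \<longleftrightarrow>
     prob_space M \<and>
     (\<forall>t. B t \<in> borel_measurable M) \<and>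
     (\<forall>\<omega>\<in>space M. B 0 \<omega> = 0) \<and>
     (\<forall>\<omega>\<in>space M. continuous_on {0..} (\<lambda>t. B t \<omega>)) \<and>
     (\<forall>s t. 0 \<le> s \<and> s < t \<longrightarrow>
        distributed M lborel (\<lambda>\<omega>. B t \<omega> - B s \<omega>) (normal_density 0 (sqrt (t - s)))) \<and>
     (\<forall>(ts::nat \<Rightarrow> real) n. 0 \<le> ts 0 \<and> (\<forall>i<n. ts i < ts (Suc i)) \<longrightarrow>
        prob_space.indep_vars M (\<lambda>_. borel) (\<lambda>i \<omega>. B (ts (Suc i)) \<omega> - B (ts i) \<omega>) {..<n})"

end

theory Submission
  imports Defs
begin

text \<open>
  Since \<open>lo \<le> W \<le> r\<close>, the ratio condition bounds the increment of \<open>W\<close> over \<open>[s k, s (k + 1)]\<close>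
  on one side, determined by \<open>k\<close> alone, by \<open>c\<^sub>1 d k\<close> with \<open>d k = sqrt (s (k + 1) - s k)\<close>. With a
  probability bounded below, independently over \<open>k\<close>, the increment of \<open>B\<close> exceeds
  \<open>(\<bar>c\<^sub>1\<bar> + 1) d k\<close> on that side, and then \<open>Y\<close> varies by at least \<open>d k\<close>. As the \<open>d k\<close> are bounded
  with infinite sum, a Chernoff bound shows that the \<open>d k\<close> of these \<open>k\<close> have infinite sum
  almost surely.
\<close>

section \<open>Uniqueness for the extended Skorokhod problem and the value of
  \<open>Gamma_bar\<close>\<close>

lemma left_lim_eqI:
  fixes f :: "real \<Rightarrow> 'b::t2_space"
  assumes "(f \<longlongrightarrow> L) (at_left t)"
  shows "left_lim f t = L"
  unfolding left_lim_def using assms by (intro tendsto_Lim) auto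

lemma cadlag_tendsto_left_lim:
  assumes "cadlag f" "t > 0"
  shows "(f \<longlongrightarrow> left_lim f t) (at_left t)"
  using assms left_lim_eqI unfolding cadlag_def by metis

text \<open>After the last time \<open>q\<close> before \<open>t\<close> with \<open>\<phi>1 \<le> \<phi>2\<close>, the path \<open>\<phi>1\<close> is off \<open>lo\<close> and \<open>\<phi>2\<close> is
  off \<open>r\<close>, so \<open>\<phi>1 - \<phi>2 = \<eta>1 - \<eta>2\<close> cannot increase, neither by a jump at \<open>q\<close> nor later.\<close>
lemma ESP_first_component_le:
  assumes 1: "ESP lo r \<psi> \<phi>1 \<eta>1" and 2: "ESP lo r \<psi> \<phi>2 \<eta>2" and t: "t \<ge> 0"
  shows "\<phi>1 t \<le> \<phi>2 t"
proof (rule ccontr)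
  assume "\<not> \<phi>1 t \<le> \<phi>2 t"
  define D where "D u = \<eta>1 u - \<eta>2 u" for u
  have phi_eta: "\<phi>1 u = \<psi> u + \<eta>1 u" "\<phi>2 u = \<psi> u + \<eta>2 u" if "u \<ge> 0" for u
    using 1 2 that unfolding ESP_def by auto
  have D_phi: "D u = \<phi>1 u - \<phi>2 u" if "u \<ge> 0" for u
    using phi_eta[OF that] by (simp add: D_def)
  have Dt: "D t > 0" using D_phi[OF t] \<open>\<not> \<phi>1 t \<le> \<phi>2 t\<close> by simp
  have off: "ereal (\<phi>1 u) > lo u \<and> ereal (\<phi>2 u) < r u" if "u \<ge> 0" "D u > 0" for u
  proof -
    have "lo u \<le> ereal (\<phi>2 u)" "ereal (\<phi>1 u) \<le> r u" using 1 2 that unfolding ESP_def by auto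
    moreover have "ereal (\<phi>2 u) < ereal (\<phi>1 u)" using D_phi that by auto
    ultimately show ?thesis by (meson le_less_trans less_le_trans)
  qed
  have decr: "D v \<le> D u" if "0 \<le> u" "u \<le> v" "\<And>z. z \<in> {u<..v} \<Longrightarrow> D z > 0" for u v
  proof -
    have "\<forall>z\<in>{u<..v}. ereal (\<phi>1 z) > lo z" "\<forall>z\<in>{u<..v}. ereal (\<phi>2 z) < r z"
      using off that by auto
    then have "\<eta>1 v - \<eta>1 u \<le> 0" "\<eta>2 v - \<eta>2 u \<ge> 0"
      using 1 2 that unfolding ESP_def by blast+
    then show ?thesis by (simp add: D_def)
  qed
  have jump: "D u \<le> eta_minus \<eta>1 u - eta_minus \<eta>2 u" if "u \<ge> 0" "D u > 0" for u
  proof -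
    have "\<eta>1 u - eta_minus \<eta>1 u \<le> 0" "\<eta>2 u - eta_minus \<eta>2 u \<ge> 0"
      using 1 2 off[OF that] that unfolding ESP_def by blast+
    then show ?thesis by (simp add: D_def)
  qed
  \<comment> \<open>Both values of \<open>eta_minus\<close> at 0 are 0, so the jump condition at
    time 0 acts as the initial condition.\<close>
  have D0: "D 0 \<le> 0" using jump[of 0] by (force simp: eta_minus_def)
  define S where "S = {u. 0 \<le> u \<and> u \<le> t \<and> D u \<le> 0}"
  define q where "q = Sup S"
  have S: "0 \<in> S" "bdd_above S" using D0 t by (auto simp: S_def intro: bdd_aboveI[of _ t])
  have q: "0 \<le> q" "q \<le> t"
    using S by (auto simp: q_def S_def intro!: cSup_upper cSup_least)
  have after: "D z > 0" if "z \<in> {q<..t}" for z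
  proof (rule ccontr)
    assume "\<not> D z > 0"
    then have "z \<in> S" using that q by (auto simp: S_def)
    then have "z \<le> q" using S by (auto simp: q_def intro: cSup_upper)
    then show False using that by auto
  qed
  \<comment> \<open>The interval condition concerns \<open>{q<..t}\<close> only, so positivity of
    \<open>D\<close> at \<open>q\<close> itself comes out as a conclusion.\<close>
  have Dq: "D q > 0" using decr[OF q after] Dt by simp
  have "q > 0" using Dq D0 q by (cases "q = 0") auto
  have "q \<notin> S" using Dq by (auto simp: S_def)
  \<comment> \<open>By \<open>jump\<close> the left limit of \<open>D\<close> at \<open>q\<close> is
    at least \<open>D q\<close>, so \<open>D\<close> is also positive just before \<open>q\<close>.
    Since \<open>q\<close> is not in \<open>S\<close>, points of \<open>S\<close> would have to
    approach it from the left, a contradiction.\<close>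
  have lim: "(D \<longlongrightarrow> left_lim \<eta>1 q - left_lim \<eta>2 q) (at_left q)"
    unfolding D_def using 1 2 \<open>q > 0\<close>
    by (intro tendsto_diff cadlag_tendsto_left_lim) (auto simp: ESP_def)
  have "left_lim \<eta>1 q - left_lim \<eta>2 q > 0"
    using jump[OF q(1) Dq] Dq \<open>q > 0\<close> by (simp add: eta_minus_def)
  then have "eventually (\<lambda>u. D u > 0) (at_left q)"
    using lim order_tendstoD(1) by blast
  then obtain b where b: "b < q" "\<And>u. b < u \<Longrightarrow> u < q \<Longrightarrow> D u > 0"
    unfolding eventually_at_left_field by auto
  obtain u where u: "u \<in> S" "b < u"
    using less_cSupD[of S b] S b unfolding q_def by auto
  have "u \<le> q" using u S by (auto simp: q_def intro: cSup_upper)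
  then have "u < q" using u \<open>q \<notin> S\<close> by (cases "u = q") auto
  then show False using b(2)[of u] u by (auto simp: S_def)
qed

text \<open>\<open>ESP\<close> leaves the values of \<open>\<phi>\<close> at negative times free,
  while \<open>Gamma_bar\<close> asks for 0 there. The truncation \<open>\<phi>0\<close> is still a
  solution, because all limits involved see only nonnegative times, and the comparison applied in
  both directions makes it the only one.\<close>

lemma Gamma_bar_solution:
  assumes "ESP lo r \<psi> \<phi> \<eta>" "t \<ge> 0"
  shows "Gamma_bar lo r \<psi> t = \<phi> t"
proof -
  define \<phi>0 where "\<phi>0 u = (if u < 0 then 0 else \<phi> u)" for u
  have lim: "(\<phi>0 \<longlongrightarrow> L) F \<longleftrightarrow> (\<phi> \<longlongrightarrow> L) F" if "eventually (\<lambda>u. u \<ge> 0) F" for F L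
    by (rule tendsto_cong) (use that in \<open>auto elim!: eventually_mono simp: \<phi>0_def\<close>)
  have right: "eventually (\<lambda>v. v \<ge> 0) (at_right u)" if "u \<ge> 0" for u :: real
    using that by (auto simp: eventually_at_right_field intro!: exI[of _ "u+1"])
  have left: "eventually (\<lambda>v. v \<ge> 0) (at_left u)" if "u > 0" for u :: real
    using that by (auto simp: eventually_at_left_field intro!: exI[of _ 0])
  have "cadlag \<phi>0"
    using assms(1) lim[OF right] lim[OF left]
    unfolding ESP_def cadlag_def by (auto simp: \<phi>0_def)
  then have 0: "ESP lo r \<psi> \<phi>0 \<eta>"
    using assms(1) unfolding ESP_def by (auto simp: \<phi>0_def)
  have "Gamma_bar lo r \<psi> = \<phi>0"
    unfolding Gamma_bar_def
  proof (rule the_equality)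
    fix \<phi>' assume "(\<exists>\<eta>. ESP lo r \<psi> \<phi>' \<eta>) \<and> (\<forall>t<0. \<phi>' t = 0)"
    then obtain \<eta>' where *: "ESP lo r \<psi> \<phi>' \<eta>'" "\<forall>t<0. \<phi>' t = 0" by auto
    show "\<phi>' = \<phi>0"
    proof
      fix u show "\<phi>' u = \<phi>0 u"
        using * ESP_first_component_le[OF *(1) 0, of u] ESP_first_component_le[OF 0 *(1), of u]
        by (cases "u < 0") (auto simp: \<phi>0_def)
    qed
  qed (use 0 in \<open>auto simp: \<phi>0_def\<close>)
  then show ?thesis using assms by (simp add: \<phi>0_def)
qed

text \<open>No existence theorem for the ESP is needed: on paths without a solution, \<open>Gamma_bar\<close> is the
  junk value of \<open>THE\<close> on the empty predicate, one function that does not depend on the path, and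
  Brownian motion minus a fixed function has infinite variation almost surely as well.\<close>
lemma Gamma_bar_no_solution:
  assumes "\<nexists>\<phi> \<eta>. ESP lo r \<psi> \<phi> \<eta>"
  shows "Gamma_bar lo r \<psi> = (THE \<phi>. False)"
  using assms by (simp add: Gamma_bar_def)

section \<open>Lower bounds for the total variation\<close>

lemma sum_increments_le_total_variation:
  assumes "a \<le> u 0" "u n \<le> b" "\<And>i. i < n \<Longrightarrow> u i \<le> u (Suc i)"
  shows "ereal (\<Sum>i<n. \<bar>f (u (Suc i)) - f (u i)\<bar>) \<le> total_variation f a b"
proof -
  \<comment> \<open>\<open>total_variation\<close> admits only partitions from \<open>a\<close> to
    \<open>b\<close>, so both end points are attached to \<open>u\<close>, which adds two
    nonnegative summands.\<close>
  define t where "t i = (case i of 0 \<Rightarrow> a | Suc j \<Rightarrow> if j \<le> n then u j else b)" for i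
  have "(\<Sum>i<n. \<bar>f (u (Suc i)) - f (u i)\<bar>) = (\<Sum>i<n. \<bar>f (t (Suc (Suc i))) - f (t (Suc i))\<bar>)"
    by (intro sum.cong) (auto simp: t_def)
  also have "\<dots> \<le> (\<Sum>i<Suc n. \<bar>f (t (Suc i)) - f (t i)\<bar>)"
    by (subst sum.lessThan_Suc_shift) auto
  also have "\<dots> \<le> (\<Sum>i<Suc (Suc n). \<bar>f (t (Suc i)) - f (t i)\<bar>)"
    by simp
  finally have le: "ereal (\<Sum>i<n. \<bar>f (u (Suc i)) - f (u i)\<bar>)
      \<le> ereal (\<Sum>i<Suc (Suc n). \<bar>f (t (Suc i)) - f (t i)\<bar>)" by simp
  have "t i \<le> t (Suc i)" if "i < Suc (Suc n)" for i
  proof (cases i)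
    case (Suc j)
    then show ?thesis using assms(3)[of j] assms(2) that by (cases "j = n") (auto simp: t_def)
  qed (use assms in \<open>auto simp: t_def\<close>)
  then have "(Suc (Suc n), t) \<in> {(n, t). t 0 = a \<and> t n = b \<and> (\<forall>i<n. t i \<le> t (Suc i))}"
    by (simp add: t_def)
  then show ?thesis
    unfolding total_variation_def by (rule SUP_upper2) (use le in simp)
qed

section \<open>Lower tails of weighted sums of independent indicators\<close>

text \<open>Follows from \<open>1 + x \<le> exp x\<close>. The slope is uniform on
  \<open>{0..A}\<close>; this is where boundedness of the weights enters the Chernoff bound.\<close>

lemma one_minus_exp_minus_ge:
  fixes x A :: real
  assumes "0 \<le> x" "x \<le> A"
  shows "x / (1 + A) \<le> 1 - exp (- x)"
proof -
  have "x / (1 + A) \<le> x / (1 + x)" using assms by (intro divide_left_mono) auto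
  also have "\<dots> = 1 - 1 / (1 + x)" using assms by (simp add: field_simps)
  also have "\<dots> \<le> 1 - 1 / exp x" using assms by (intro diff_left_mono divide_left_mono) auto
  finally show ?thesis by (simp add: exp_minus field_simps)
qed

text \<open>A Chernoff bound: the Laplace transform of the random sum factorizes.\<close>
lemma (in prob_space) weighted_indicators_lower_tail:
  fixes X :: "'i \<Rightarrow> 'a \<Rightarrow> real"
  assumes fin: "finite I" and ind: "indep_vars (\<lambda>_. borel) X I"
    and Z: "\<And>i. i \<in> I \<Longrightarrow> Z i \<in> sets borel"
    and p: "\<And>i. i \<in> I \<Longrightarrow> p \<le> prob {\<omega> \<in> space M. X i \<omega> \<in> Z i}" "0 \<le> p"
    and a: "\<And>i. i \<in> I \<Longrightarrow> 0 \<le> a i \<and> a i \<le> A"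
  shows "prob {\<omega> \<in> space M. (\<Sum>i\<in>I. a i * indicator (Z i) (X i \<omega>)) \<le> m}
    \<le> exp (m - p / (1 + A) * (\<Sum>i\<in>I. a i))"
proof -
  have X: "X i \<in> borel_measurable M" if "i \<in> I" for i
    using ind that by (auto simp: indep_vars_def2)
  define E where "E i = (\<lambda>y. exp (- (a i * indicator (Z i) y)) :: real)" for i
  define S where "S \<omega> = (\<Sum>i\<in>I. a i * indicator (Z i) (X i \<omega>))" for \<omega>
  have E: "E i \<in> borel_measurable borel" if "i \<in> I" for i
    using Z[OF that] unfolding E_def by measurable
  have ind': "indep_vars (\<lambda>_. borel) (\<lambda>i \<omega>. E i (X i \<omega>)) I"
    using ind E by (rule indep_vars_compose2)
  have int: "integrable M (\<lambda>\<omega>. E i (X i \<omega>))" if "i \<in> I" for i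
    using measurable_compose[OF X[OF that] E[OF that]] a[OF that]
    by (intro integrable_const_bound[where B=1]) (auto simp: E_def indicator_def)
  have expE: "expectation (\<lambda>\<omega>. E i (X i \<omega>)) \<le> exp (- (p / (1 + A) * a i))" if i: "i \<in> I" for i
  proof -
    let ?Q = "{\<omega> \<in> space M. X i \<omega> \<in> Z i}"
    have Q: "?Q \<in> events" using X[OF i] Z[OF i] by measurable
    \<comment> \<open>The variable is \<open>exp (- a i)\<close> on \<open>?Q\<close> and 1 off it.
      A lower bound on \<open>1 - exp (- a i)\<close> linear in \<open>a i\<close>, followed by
      \<open>1 - y \<le> exp (- y)\<close>, lets the exponents add up in the product over
      \<open>I\<close>.\<close>
    have "expectation (\<lambda>\<omega>. E i (X i \<omega>)) = expectation (\<lambda>\<omega>. 1 - (1 - exp (- a i)) * indicator ?Q \<omega>)"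
      by (intro Bochner_Integration.integral_cong) (auto simp: E_def indicator_def)
    also have "\<dots> = 1 - (1 - exp (- a i)) * prob ?Q"
      using Q by (subst Bochner_Integration.integral_diff)
        (auto simp: prob_space less_top[symmetric] intro!: integrable_real_indicator)
    also have "\<dots> \<le> 1 - (a i / (1 + A)) * p"
      using a[OF i] p i by (intro diff_left_mono mult_mono one_minus_exp_minus_ge) auto
    also have "\<dots> \<le> exp (- (p / (1 + A) * a i))"
      using exp_ge_add_one_self[of "- (p / (1 + A) * a i)"] by (simp add: mult.commute)
    finally show ?thesis .
  qed
  have expS: "exp (- S \<omega>) = (\<Prod>i\<in>I. E i (X i \<omega>))" for \<omega>
    unfolding S_def E_def sum_negf[symmetric] using fin by (rule exp_sum)
  have S: "S \<in> borel_measurable M"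
    unfolding S_def using measurable_compose[OF X borel_measurable_indicator[OF Z]]
    by (intro borel_measurable_sum borel_measurable_times borel_measurable_const)
  have S0: "S \<omega> \<ge> 0" for \<omega> unfolding S_def using a by (intro sum_nonneg) auto
  \<comment> \<open>Exponential Markov inequality: on the event, \<open>m - S \<omega>\<close> is
    nonnegative, so its exponential dominates the indicator.\<close>
  have "prob {\<omega> \<in> space M. S \<omega> \<le> m} = expectation (indicator {\<omega> \<in> space M. S \<omega> \<le> m})"
    using S by simp
  also have "\<dots> \<le> expectation (\<lambda>\<omega>. exp m * exp (- S \<omega>))"
  proof (rule integral_mono)
    show "integrable M (indicator {\<omega> \<in> space M. S \<omega> \<le> m} :: _ \<Rightarrow> real)"
      using S by (intro integrable_real_indicator) (auto simp: less_top[symmetric])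
    show "integrable M (\<lambda>\<omega>. exp m * exp (- S \<omega>))"
      using S S0 by (intro integrable_mult_right integrable_const_bound[where B=1]) auto
  qed (auto simp: indicator_def exp_add[symmetric])
  also have "\<dots> = exp m * (\<Prod>i\<in>I. expectation (\<lambda>\<omega>. E i (X i \<omega>)))"
    using indep_vars_lebesgue_integral[OF fin ind' int] by (simp add: expS)
  also have "\<dots> \<le> exp m * (\<Prod>i\<in>I. exp (- (p / (1 + A) * a i)))"
    using expE by (intro mult_left_mono prod_mono) (auto simp: E_def intro!: integral_nonneg_AE)
  also have "\<dots> = exp (m - p / (1 + A) * (\<Sum>i\<in>I. a i))"
    by (simp only: exp_sum[OF fin, symmetric] exp_add[symmetric] sum_negf sum_distrib_left
        diff_conv_add_uminus)
  finally show ?thesis by (simp add: S_def)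
qed

text \<open>The event that every \<open>S n\<close> stays below \<open>k\<close> lies in each single
  event \<open>S n \<le> k\<close>, so its probability is at most the limit 0. Countably many levels
  \<open>k\<close> suffice by the Archimedean property.\<close>

lemma (in prob_space) AE_exists_gt:
  fixes S :: "nat \<Rightarrow> 'a \<Rightarrow> real"
  assumes S: "\<And>n. S n \<in> borel_measurable M"
    and "\<And>m. (\<lambda>n. prob {\<omega> \<in> space M. S n \<omega> \<le> m}) \<longlonglongrightarrow> 0"
  shows "AE \<omega> in M. \<forall>m. \<exists>n. S n \<omega> > m"
proof -
  have "AE \<omega> in M. \<exists>n. S n \<omega> > real k" for k :: nat
  proof -
    let ?N = "{\<omega> \<in> space M. \<forall>n. S n \<omega> \<le> real k}"
    have N: "?N \<in> events" using S by measurable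
    have "prob ?N \<le> prob {\<omega> \<in> space M. S n \<omega> \<le> real k}" for n
      using S by (intro finite_measure_mono) auto
    then have "prob ?N \<le> 0" using assms(2)[of "real k"] by (intro LIMSEQ_le_const) auto
    then have "prob ?N = 0" by (simp add: measure_le_0_iff)
    then have "AE \<omega> in M. \<omega> \<notin> ?N" using N prob_eq_0 by blast
    then show ?thesis by (rule AE_mp) (auto simp: not_le)
  qed
  then have "AE \<omega> in M. \<forall>k::nat. \<exists>n. S n \<omega> > real k" by (simp add: AE_all_countable)
  then show ?thesis
  proof eventually_elim
    case (elim \<omega>)
    then show ?case by (metis less_trans reals_Archimedean2)
  qed
qed

section \<open>Brownian motion against paths with one-sided increment bounds\<close>

text \<open>The density vanishes nowhere, so a null set of the Gaussian measure is a Lebesgue null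
  set. Applied to half-lines, this makes the success probability positive.\<close>

lemma std_normal_density_measure_pos:
  assumes "A \<in> sets lborel" "emeasure lborel A > 0"
  shows "emeasure (density lborel std_normal_density) A > 0"
proof (rule ccontr)
  assume "\<not> ?thesis"
  then have "AE x in lborel. ennreal (std_normal_density x) * indicator A x = 0"
    using assms by (simp add: emeasure_density nn_integral_0_iff_AE)
  then have "AE x in lborel. x \<notin> A"
  proof eventually_elim
    case (elim x)
    then show ?case using normal_density_pos[of 1 0 x] by (auto simp: indicator_def split: if_splits)
  qed
  then have "emeasure lborel A = 0"
    using assms(1) AE_iff_null_sets by blast
  then show False using assms(2) by simp
qed

text \<open>Independence of Brownian increments is available along consecutive times, so a large
  finite partial sum is needed over a block of consecutive indices. The integer interval spanned by
  a finite set \<open>F\<close> stays in \<open>K\<close> and only increases the sum.\<close>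

lemma chunk_sum_unbounded:
  fixes f :: "int \<Rightarrow> real"
  assumes conv: "\<forall>a\<in>K. \<forall>b\<in>K. \<forall>c. a \<le> c \<and> c \<le> b \<longrightarrow> c \<in> K"
    and f: "\<And>k. k \<in> K \<Longrightarrow> 0 \<le> f k"
    and inf: "(\<Sum>\<^sub>\<infinity>k\<in>K. ennreal (f k)) = \<infinity>"
    and N: "0 \<le> N"
  shows "\<exists>a n. a \<in> K \<and> (\<forall>i<n. a + int i \<in> K) \<and> N \<le> (\<Sum>i<n. f (a + int i))"
proof -
  have "(SUP F\<in>{F. finite F \<and> F \<subseteq> K}. \<Sum>k\<in>F. ennreal (f k)) = \<infinity>"
    using inf by (subst (asm) nonneg_infsum_complete) auto
  then have "ennreal N < (SUP F\<in>{F. finite F \<and> F \<subseteq> K}. \<Sum>k\<in>F. ennreal (f k))"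
    by (metis ennreal_less_top infinity_ennreal_def)
  then obtain F where F: "finite F" "F \<subseteq> K" "ennreal N < (\<Sum>k\<in>F. ennreal (f k))"
    by (auto simp: less_SUP_iff)
  then have "F \<noteq> {}" by auto
  define a b where "a = Min F" and "b = Max F"
  have ab: "a \<in> K" "b \<in> K" "F \<subseteq> {a..b}" "{a..b} \<subseteq> K"
  proof -
    show "a \<in> K" "b \<in> K" using F \<open>F \<noteq> {}\<close> Min_in[of F] Max_in[of F] by (auto simp only: a_def b_def)
    then show "{a..b} \<subseteq> K" using conv by (meson atLeastAtMost_iff subsetI)
    show "F \<subseteq> {a..b}" using F by (auto simp: a_def b_def)
  qed
  define n where "n = nat (b - a + 1)"
  have "ennreal N \<le> ennreal (\<Sum>k\<in>F. f k)"
    using F f by (subst sum_ennreal[symmetric]) (auto intro: less_imp_le)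
  then have "N \<le> (\<Sum>k\<in>F. f k)" using f F by (subst (asm) ennreal_le_iff) (auto intro!: sum_nonneg)
  also have "\<dots> \<le> (\<Sum>k\<in>{a..b}. f k)" using ab f by (intro sum_mono2) auto
  also have "\<dots> = (\<Sum>i<n. f (a + int i))"
    by (rule sum.reindex_bij_witness[of _ "\<lambda>i. a + int i" "\<lambda>k. nat (k - a)"]) (auto simp: n_def)
  finally have "N \<le> (\<Sum>i<n. f (a + int i))" .
  moreover have "\<forall>i<n. a + int i \<in> K" using ab by (auto simp: n_def subset_iff)
  ultimately show ?thesis using ab by blast
qed

text \<open>The exceptional null set does not depend on \<open>w\<close>, so \<open>w\<close> may be chosen as a function
  of the path; only the side on which its increments are bounded has to be deterministic.\<close>
lemma brownian_total_variation_infinite: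
  fixes s :: "int \<Rightarrow> real" and up :: "int \<Rightarrow> bool"
  assumes BM: "std_brownian_motion M B"
    and conv: "\<forall>a\<in>K. \<forall>b\<in>K. \<forall>c. a \<le> c \<and> c \<le> b \<longrightarrow> c \<in> K"
    and s: "\<And>k. k \<in> K \<Longrightarrow> 0 \<le> s k \<and> s k < s (k + 1) \<and> s (k + 1) \<le> \<tau>"
    and \<tau>: "0 < \<tau>"
    and inf: "(\<Sum>\<^sub>\<infinity>k\<in>K. ennreal (sqrt (s (k + 1) - s k))) = \<infinity>"
  shows "AE \<omega> in M. \<forall>w::real \<Rightarrow> real.
    (\<forall>k\<in>K. if up k then w (s (k + 1)) - w (s k) \<le> c * sqrt (s (k + 1) - s k)
           else - c * sqrt (s (k + 1) - s k) \<le> w (s (k + 1)) - w (s k)) \<longrightarrow>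
    total_variation (\<lambda>t. w t - x - B t \<omega>) 0 \<tau> = \<infinity>"
proof -
  interpret prob_space M using BM by (simp add: std_brownian_motion_def)
  define d where "d k = sqrt (s (k + 1) - s k)" for k
  \<comment> \<open>Dividing by \<open>d k\<close> makes the increment standard normal for
    \<open>k\<close> in \<open>K\<close>, so the probability of its tail \<open>Z k\<close> takes
    only two values, and \<open>p\<close> is the smaller one.\<close>
  define X where "X k \<omega> = (B (s (k + 1)) \<omega> - B (s k) \<omega>) / d k" for k \<omega>
  define C where "C = \<bar>c\<bar> + 1"
  define Z where "Z k = (if up k then {C..} else {..-C})" for k
  define G where "G = density lborel std_normal_density"
  define p where "p = min (measure G {C..}) (measure G {..-C})"
  interpret G: prob_space G unfolding G_def by (rule prob_space_normal_density) simp
  have d: "0 < d k" "d k \<le> sqrt \<tau>" if "k \<in> K" for k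
    using s[OF that] by (auto simp: d_def)
  have BM_meas: "B t \<in> borel_measurable M" for t
    using BM by (simp add: std_brownian_motion_def)
  have Z: "Z k \<in> sets borel" for k by (simp add: Z_def)
  have X: "X k \<in> borel_measurable M" for k unfolding X_def using BM_meas by measurable
  have "emeasure lborel {C..C + 1} \<le> emeasure lborel {C..}"
    "emeasure lborel {-C - 1..-C} \<le> emeasure lborel {..-C}" by (intro emeasure_mono; auto)+
  then have "emeasure G {C..} > 0" "emeasure G {..-C} > 0"
    unfolding G_def by (auto intro!: std_normal_density_measure_pos intro: less_le_trans[of 0 1])
  then have p: "0 < p" by (simp add: p_def G.emeasure_eq_measure)
  have prob_ge: "p \<le> prob {\<omega> \<in> space M. X k \<omega> \<in> Z k}" if k: "k \<in> K" for k
  proof -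
    have "distributed M lborel (\<lambda>\<omega>. B (s (k + 1)) \<omega> - B (s k) \<omega>) (normal_density 0 (d k))"
      using BM s[OF k] unfolding std_brownian_motion_def d_def by blast
    then have "distributed M lborel (X k) std_normal_density"
      using normal_standard_normal_convert[OF d(1)[OF k], of "\<lambda>\<omega>. B (s (k + 1)) \<omega> - B (s k) \<omega>" 0]
      by (simp add: X_def[abs_def])
    then have "distr M lborel (X k) = G" unfolding G_def by (rule distributed_distr_eq_density)
    then have "measure G (Z k) = measure (distr M lborel (X k)) (Z k)" by simp
    also have "\<dots> = prob {\<omega> \<in> space M. X k \<omega> \<in> Z k}"
      using X Z by (subst measure_distr) (auto intro: arg_cong[where f=prob])
    finally show ?thesis by (auto simp: p_def Z_def split: if_splits)
  qed
  have "\<exists>a n. a \<in> K \<and> (\<forall>i<n. a + int i \<in> K) \<and> real N \<le> (\<Sum>i<n. d (a + int i))" for N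
    using chunk_sum_unbounded[OF conv _ inf[folded d_def]] d(1) by (simp add: less_imp_le)
  \<comment> \<open>One block of total weight at least \<open>N\<close> for each \<open>N\<close>.
    Blocks may overlap: independence is used only inside a block.\<close>
  then obtain a n where chunk: "\<And>N::nat. a N \<in> K" "\<And>N i. i < n N \<Longrightarrow> a N + int i \<in> K"
    "\<And>N. real N \<le> (\<Sum>i<n N. d (a N + int i))"
    by metis
  define S where "S N \<omega> = (\<Sum>i<n N. d (a N + int i) *
      indicator (Z (a N + int i)) (X (a N + int i) \<omega>))" for N \<omega>
  \<comment> \<open>The rate in the Chernoff bound, with \<open>sqrt \<tau>\<close> as the bound
    \<open>A\<close> on the weights \<open>d k\<close>.\<close>
  define q where "q = p / (1 + sqrt \<tau>)"
  have q: "0 < q" using p \<tau> by (simp add: q_def add_pos_pos)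
  have tail: "prob {\<omega> \<in> space M. S N \<omega> \<le> m} \<le> exp m * exp (- q) ^ N" for N m
  proof -
    define ts where "ts i = s (a N + int i)" for i
    have ts_Suc: "ts (Suc i) = s (a N + int i + 1)" for i by (simp add: ts_def algebra_simps)
    have "0 \<le> ts 0" using s[OF chunk(1)[of N]] by (simp add: ts_def)
    moreover have "\<forall>i<n N. ts i < ts (Suc i)"
      using s chunk(2)[of _ N] unfolding ts_Suc by (auto simp: ts_def)
    ultimately have "indep_vars (\<lambda>_. borel) (\<lambda>i \<omega>. B (ts (Suc i)) \<omega> - B (ts i) \<omega>) {..<n N}"
      using BM unfolding std_brownian_motion_def by blast
    then have "indep_vars (\<lambda>_. borel) (\<lambda>i \<omega>. (B (ts (Suc i)) \<omega> - B (ts i) \<omega>) / d (a N + int i)) {..<n N}"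
      by (rule indep_vars_compose2) auto
    then have ind: "indep_vars (\<lambda>_. borel) (\<lambda>i. X (a N + int i)) {..<n N}"
      unfolding ts_Suc by (simp add: ts_def X_def[abs_def])
    have "prob {\<omega> \<in> space M. S N \<omega> \<le> m} \<le> exp (m - q * (\<Sum>i<n N. d (a N + int i)))"
      unfolding S_def q_def
      by (rule weighted_indicators_lower_tail[OF _ ind])
         (use Z p chunk(2) d prob_ge in \<open>auto simp: less_imp_le\<close>)
    also have "\<dots> \<le> exp (m - q * real N)"
      using chunk(3)[of N] q by auto
    also have "m - q * real N = m + real N * (- q)" by simp
    also have "exp \<dots> = exp m * exp (- q) ^ N" by (simp only: exp_add exp_of_nat_mult)
    finally show ?thesis .
  qed
  have "(\<lambda>N. prob {\<omega> \<in> space M. S N \<omega> \<le> m}) \<longlonglongrightarrow> 0" for m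
  proof (rule tendsto_sandwich[OF _ _ tendsto_const])
    show "(\<lambda>N. exp m * exp (- q) ^ N) \<longlonglongrightarrow> 0"
      using q by (intro tendsto_mult_right_zero LIMSEQ_power_zero) auto
  qed (use tail in auto)
  moreover have "S N \<in> borel_measurable M" for N
    unfolding S_def using measurable_compose[OF X borel_measurable_indicator[OF Z]]
    by (intro borel_measurable_sum borel_measurable_times borel_measurable_const)
  ultimately have "AE \<omega> in M. \<forall>m. \<exists>N. S N \<omega> > m" by (intro AE_exists_gt)
  then show ?thesis
  proof (eventually_elim, intro allI impI)
    fix \<omega> and w :: "real \<Rightarrow> real"
    assume big: "\<forall>m. \<exists>N. S N \<omega> > m"
      and w: "\<forall>k\<in>K. if up k then w (s (k + 1)) - w (s k) \<le> c * sqrt (s (k + 1) - s k)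
           else - c * sqrt (s (k + 1) - s k) \<le> w (s (k + 1)) - w (s k)"
    define f where "f t = w t - x - B t \<omega>" for t
    have increment: "d k * indicator (Z k) (X k \<omega>) \<le> \<bar>f (s (k + 1)) - f (s k)\<bar>" if k: "k \<in> K" for k
    proof (cases "X k \<omega> \<in> Z k")
      case True
      \<comment> \<open>The increment of \<open>B\<close> is at least \<open>C * d k\<close> on the
        side where that of \<open>w\<close> is at most \<open>c * d k\<close>; the difference of
        these bounds is at least \<open>d k\<close>.\<close>
      have "(c + 1) * d k \<le> C * d k" using d(1)[OF k] by (intro mult_right_mono) (auto simp: C_def)
      then have "c * d k + d k \<le> C * d k" by (simp add: algebra_simps)
      moreover have "up k \<Longrightarrow> C * d k \<le> B (s (k + 1)) \<omega> - B (s k) \<omega>"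
        "\<not> up k \<Longrightarrow> B (s (k + 1)) \<omega> - B (s k) \<omega> \<le> - C * d k"
        using True d(1)[OF k] by (auto simp: Z_def X_def field_simps)
      moreover have "if up k then w (s (k + 1)) - w (s k) \<le> c * d k
          else - c * d k \<le> w (s (k + 1)) - w (s k)"
        using w k by (auto simp: d_def)
      ultimately show ?thesis using True by (cases "up k") (auto simp: f_def)
    qed auto
    have S_le: "ereal (S N \<omega>) \<le> total_variation f 0 \<tau>" for N
    proof -
      define u where "u i = s (a N + int i)" for i
      have u_Suc: "u (Suc i) = s (a N + int i + 1)" for i by (simp add: u_def algebra_simps)
      have "S N \<omega> \<le> (\<Sum>i<n N. \<bar>f (u (Suc i)) - f (u i)\<bar>)"
        unfolding S_def u_Suc by (intro sum_mono) (use increment chunk(2)[of _ N] in \<open>auto simp: u_def\<close>)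
      then have "ereal (S N \<omega>) \<le> ereal (\<Sum>i<n N. \<bar>f (u (Suc i)) - f (u i)\<bar>)" by simp
      also have "\<dots> \<le> total_variation f 0 \<tau>"
      proof (rule sum_increments_le_total_variation)
        show "0 \<le> u 0" using s[OF chunk(1)[of N]] by (simp add: u_def)
        show "u i \<le> u (Suc i)" if "i < n N" for i
          using s[OF chunk(2)[OF that]] unfolding u_Suc by (simp add: u_def)
        show "u (n N) \<le> \<tau>"
        \<comment> \<open>A block may be empty; then \<open>u (n N)\<close> is
          \<open>s (a N)\<close>, which is bounded because \<open>a N\<close> lies in
          \<open>K\<close>.\<close>
        proof (cases "n N")
          case 0
          then show ?thesis using s[OF chunk(1)[of N]] by (simp add: u_def)
        next
          case (Suc j)
          then show ?thesis using s[OF chunk(2)[of j N]] by (simp add: u_Suc)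
        qed
      qed
      finally show ?thesis .
    qed
    have "total_variation f 0 \<tau> = \<infinity>"
    proof (rule ereal_top)
      fix m :: real
      obtain N where "m < S N \<omega>" using big by auto
      then show "ereal m \<le> total_variation f 0 \<tau>"
        using S_le[of N] by (meson ereal_less_eq(3) less_imp_le order_trans)
    qed
    then show "total_variation (\<lambda>t. w t - x - B t \<omega>) 0 \<tau> = \<infinity>" by (simp add: f_def[abs_def])
  qed
qed

section \<open>From the barriers to one-sided increment bounds for the reflected path\<close>

theorem theorem4p2:
  fixes M :: "'a measure" and B :: "real \<Rightarrow> 'a \<Rightarrow> real"
    and lo r :: "real \<Rightarrow> ereal" and x :: real and \<tau> :: real
    and K' :: "int set" and s :: "int \<Rightarrow> real" and c\<^sub>1 :: real
    and W Y :: "'a \<Rightarrow> real \<Rightarrow> real"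
  assumes BM: "std_brownian_motion M B"
    and l: "lo \<in> D_minus" and r: "r \<in> D_plus" and lr: "\<forall>t\<ge>0. lo t \<le> r t"
    and W_def: "\<And>\<omega>. W \<omega> = Gamma_bar lo r (\<lambda>t. x + B t \<omega>)"
    and Y_def: "\<And>\<omega> t. Y \<omega> t = W \<omega> t - x - B t \<omega>"
    and tau_fin: "{t. t > 0 \<and> (r t = lo t \<or> left_lim r t = left_lim lo t)} \<noteq> {}"
    and tau_def: "\<tau> = Inf {t. t > 0 \<and> (r t = lo t \<or> left_lim r t = left_lim lo t)}"
    and tau_pos: "\<tau> > 0"
    and K'_int: "\<forall>a\<in>K'. \<forall>b\<in>K'. \<forall>c. a \<le> c \<and> c \<le> b \<longrightarrow> c \<in> K'"
    and s_mono: "strict_mono_on K' s"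
    and s_range: "\<forall>k\<in>K'. s k \<in> {0..\<tau>}"
    and ratio: "\<forall>k \<in> (K' - {m\<in>K'. \<forall>j\<in>K'. j \<le> m}).
        min (r (s (k+1)) - lo (s k)) (- lo (s (k+1)) + r (s k)) / ereal (sqrt (s (k+1) - s k))
          \<le> ereal c\<^sub>1"
    and sum_inf: "(\<Sum>\<^sub>\<infinity>k \<in> (K' - {m\<in>K'. \<forall>j\<in>K'. j \<le> m}).
        ennreal (sqrt (s (k+1) - s k))) = \<infinity>"
  shows "AE \<omega> in M. total_variation (Y \<omega>) 0 \<tau> = \<infinity>"
proof -
  define K where "K = K' - {m\<in>K'. \<forall>j\<in>K'. j \<le> m}"
  define d where "d k = sqrt (s (k + 1) - s k)" for k
  \<comment> \<open>An element of \<open>K\<close> is not the largest of \<open>K'\<close>, so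
    something in \<open>K'\<close> exceeds it, and \<open>K'\<close> is an interval of
    integers.\<close>
  have succ: "k \<in> K'" "k + 1 \<in> K'" if k: "k \<in> K" for k
  proof -
    obtain j where "j \<in> K'" "k < j" "k \<in> K'" using k by (auto simp: K_def not_le)
    then show "k \<in> K'" "k + 1 \<in> K'" using K'_int[rule_format, of k j "k + 1"] by auto
  qed
  have conv: "\<forall>a\<in>K. \<forall>b\<in>K. \<forall>c. a \<le> c \<and> c \<le> b \<longrightarrow> c \<in> K"
  proof (intro ballI allI impI)
    fix a b c assume *: "a \<in> K" "b \<in> K" "a \<le> c \<and> c \<le> b"
    then have "c \<in> K'" using K'_int succ(1) by blast
    moreover obtain j where "j \<in> K'" "b < j" using * by (auto simp: K_def not_le)
    ultimately show "c \<in> K" using * by (auto simp: K_def not_le intro!: bexI[of _ j])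
  qed
  have s: "0 \<le> s k \<and> s k < s (k + 1) \<and> s (k + 1) \<le> \<tau>" if k: "k \<in> K" for k
    using s_range succ[OF k] s_mono by (auto simp: strict_mono_on_def)
  have infinite_variation: "AE \<omega> in M. \<forall>w.
    (\<forall>k\<in>K. if up k then w (s (k + 1)) - w (s k) \<le> c * sqrt (s (k + 1) - s k)
           else - c * sqrt (s (k + 1) - s k) \<le> w (s (k + 1)) - w (s k)) \<longrightarrow>
    total_variation (\<lambda>t. w t - x - B t \<omega>) 0 \<tau> = \<infinity>" for up c
    by (rule brownian_total_variation_infinite
        [OF BM conv s tau_pos sum_inf[folded K_def]])
  \<comment> \<open>The side records which term of the minimum in \<open>ratio\<close> is small; it
    depends on \<open>lo\<close>, \<open>r\<close> and \<open>s\<close> only, hence not on the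
    path.\<close>
  define up where "up k \<longleftrightarrow> r (s (k + 1)) - lo (s k) \<le> ereal (c\<^sub>1 * d k)" for k
  define f0 :: "real \<Rightarrow> real" where "f0 = (THE \<phi>. False)"
  have increments: "if up k then \<phi> (s (k + 1)) - \<phi> (s k) \<le> c\<^sub>1 * sqrt (s (k + 1) - s k)
           else - c\<^sub>1 * sqrt (s (k + 1) - s k) \<le> \<phi> (s (k + 1)) - \<phi> (s k)"
    if k: "k \<in> K" and \<phi>: "\<And>t. t \<ge> 0 \<Longrightarrow> lo t \<le> ereal (\<phi> t) \<and> ereal (\<phi> t) \<le> r t" for \<phi> k
  proof -
    have pos: "d k > 0" "0 \<le> s k" "0 \<le> s (k + 1)" using s[OF k] by (auto simp: d_def)
    have "min (r (s (k + 1)) - lo (s k)) (- lo (s (k + 1)) + r (s k)) / ereal (d k) \<le> ereal c\<^sub>1"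
      using ratio k by (auto simp: K_def d_def)
    then have "min (r (s (k + 1)) - lo (s k)) (- lo (s (k + 1)) + r (s k)) \<le> ereal (c\<^sub>1 * d k)"
      using pos by (subst (asm) ereal_divide_le_pos) (auto simp: mult.commute)
    then have cases: "up k \<or> - lo (s (k + 1)) + r (s k) \<le> ereal (c\<^sub>1 * d k)"
      by (auto simp: up_def min_le_iff_disj)
    have "ereal (\<phi> (s (k + 1)) - \<phi> (s k)) \<le> r (s (k + 1)) - lo (s k)"
      using \<phi>[OF pos(2)] \<phi>[OF pos(3)] unfolding ereal_minus(1)[symmetric]
      by (intro ereal_minus_mono) auto
    moreover have "ereal (- \<phi> (s (k + 1)) + \<phi> (s k)) \<le> - lo (s (k + 1)) + r (s k)"
      using \<phi>[OF pos(2)] \<phi>[OF pos(3)]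
      unfolding plus_ereal.simps(1)[symmetric] uminus_ereal.simps(1)[symmetric]
      by (intro add_mono) (auto simp only: ereal_minus_le_minus)
    ultimately have "up k \<Longrightarrow> \<phi> (s (k + 1)) - \<phi> (s k) \<le> c\<^sub>1 * d k"
      "\<not> up k \<Longrightarrow> - \<phi> (s (k + 1)) + \<phi> (s k) \<le> c\<^sub>1 * d k"
      using cases unfolding up_def by (meson ereal_less_eq(3) order_trans)+
    then show ?thesis by (auto simp: d_def)
  qed
  show ?thesis
    \<comment> \<open>The first instance serves paths with a solution. The second serves the fixed
      function \<open>f0\<close>: choosing the side by the sign of its own increments makes the
      bound hold with constant 0.\<close>
    using infinite_variation[where up = up and c = c\<^sub>1]
      infinite_variation[where up = "\<lambda>k. f0 (s (k + 1)) \<le> f0 (s k)" and c = 0]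
  proof eventually_elim
    case (elim \<omega>)
    let ?\<psi> = "\<lambda>t. x + B t \<omega>"
    have Y: "Y \<omega> = (\<lambda>t. Gamma_bar lo r ?\<psi> t - x - B t \<omega>)" by (auto simp: Y_def W_def)
    show ?case
    proof (cases "\<exists>\<phi> \<eta>. ESP lo r ?\<psi> \<phi> \<eta>")
      case True
      then obtain \<phi> \<eta> where ESP: "ESP lo r ?\<psi> \<phi> \<eta>" by blast
      have "lo t \<le> ereal (Gamma_bar lo r ?\<psi> t) \<and> ereal (Gamma_bar lo r ?\<psi> t) \<le> r t"
        if "t \<ge> 0" for t
        using ESP that unfolding Gamma_bar_solution[OF ESP that] by (auto simp: ESP_def)
      then show ?thesis unfolding Y using elim(1) increments by blast
    next
      case False
      then have "Gamma_bar lo r ?\<psi> = f0" using Gamma_bar_no_solution by (auto simp: f0_def)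
      then show ?thesis unfolding Y using elim(2) by auto
    qed
  qed
qed

end
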